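(* Let $k=\mathbb F_q$ be a finite field and let $\Lambda$ be a finite-dimensional basic split $k$-algebra with Jacobson radical $J$ satisfying $J^n=0$. Let $e_i,e_j$ be primitive idempotents with $V_{ij}=e_jJ^{n-1}e_i\neq 0$ and set $m_{ij}=\dim_kV_{ij}$. Then, for every $1\le s\le m_{ij}$, the number of isomorphism classes of rank-$s$ terminal completions with the prescribed proper radical truncation tower is $$\left|\mathcal F^{<n,\mathrm{top},s}_{ij}\right|={m_{ij}\brack s}_q,\qquad\text{where}\qquad {m\brack s}_q=\prod_{r=0}^{s-1}\frac{q^{m-r}-1}{q^{s-r}-1}$$ is the Gaussian binomial coefficient.
   Context: Modules are finite-dimensional left $\Lambda$-modules, $n\ge 1$, $J^0=\Lambda$. Fix a complete set $e_1,\dots,e_t$ of primitive orthogonal idempotents of $\Lambda$, with $e_i,e_j$ among them; $\Lambda$ basic means the modules $\Lambda e_h$ are pairwise non-isomorphic, and split means $D_h=e_h\Lambda e_h/e_hJe_h\cong k$ for every $h$. Put $P_i=\Lambda e_i$ and $W_j=\bigoplus_{h\ne j}e_hJ^{n-1}P_i$. For a $k$-subspace $U\subseteq V_{ij}$ of codimension $s$ put $K_U=W_j\oplus U\subseteq J^{n-1}P_i$ (a $\Lambda$-submodule of $P_i$) and $M_U=P_i/K_U$. The modules $M_U$ are the rank-$s$ terminal completions; the prescribed proper radical truncation tower is $M_U/J^dM_U\cong P_i/J^dP_i$, $1\le d<n$. $\mathcal F^{<n,\mathrm{top},s}_{ij}$ is the set of isomorphism classes of the modules $M_U$ as $U$ ranges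 over the codimension-$s$ subspaces of $V_{ij}$. *)

theory Defs
  imports Complex_Main "HOL-Library.Cardinality" "HOL-Library.Set_Algebras"
begin

text \<open>
  Throughout, the algebra is a whole type \<open>'r::ring_1\<close>, not assumed commutative; the scalar action
  of the ground field is an explicit function \<open>scale\<close>, as in the library locale \<open>vector_space\<close>.
\<close>

locale finite_dim_algebra = vector_space scale
  for scale :: "'k::field \<Rightarrow> 'r::ring_1 \<Rightarrow> 'r" +
  assumes finite_dim: "\<exists>B. finite B \<and> span B = UNIV"
    and scale_mult_left: "scale c x * y = scale c (x * y)"
    and scale_mult_right: "x * scale c y = scale c (x * y)"

text \<open>The library locale \<open>module\<close> requires commutative scalars and a module that is a whole type.\<close>

record ('r, 'm) lmod =
  mcarrier :: "'m set"
  madd :: "'m \<Rightarrow> 'm \<Rightarrow> 'm"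
  mzero :: "'m"
  msmult :: "'r \<Rightarrow> 'm \<Rightarrow> 'm"

locale left_module =
  fixes M :: "('r::ring_1, 'm) lmod"
  assumes zero_closed: "mzero M \<in> mcarrier M"
    and add_closed: "\<lbrakk>x \<in> mcarrier M; y \<in> mcarrier M\<rbrakk> \<Longrightarrow> madd M x y \<in> mcarrier M"
    and smult_closed: "x \<in> mcarrier M \<Longrightarrow> msmult M a x \<in> mcarrier M"
    and add_assoc: "\<lbrakk>x \<in> mcarrier M; y \<in> mcarrier M; z \<in> mcarrier M\<rbrakk>
          \<Longrightarrow> madd M (madd M x y) z = madd M x (madd M y z)"
    and add_commute: "\<lbrakk>x \<in> mcarrier M; y \<in> mcarrier M\<rbrakk> \<Longrightarrow> madd M x y = madd M y x"
    and zero_add: "x \<in> mcarrier M \<Longrightarrow> madd M (mzero M) x = x"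
    and add_inverse: "x \<in> mcarrier M \<Longrightarrow> \<exists>y\<in>mcarrier M. madd M x y = mzero M"
    and smult_add_left: "x \<in> mcarrier M
          \<Longrightarrow> msmult M (a + b) x = madd M (msmult M a x) (msmult M b x)"
    and smult_add_right: "\<lbrakk>x \<in> mcarrier M; y \<in> mcarrier M\<rbrakk>
          \<Longrightarrow> msmult M a (madd M x y) = madd M (msmult M a x) (msmult M a y)"
    and smult_smult: "x \<in> mcarrier M \<Longrightarrow> msmult M (a * b) x = msmult M a (msmult M b x)"
    and smult_one: "x \<in> mcarrier M \<Longrightarrow> msmult M 1 x = x"

text \<open>Closure under negation is automatic, since \<open>- x = (- 1) x\<close>.\<close>

definition submodule :: "'m set \<Rightarrow> ('r::ring_1, 'm) lmod \<Rightarrow> bool" where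
  "submodule N M \<longleftrightarrow> N \<subseteq> mcarrier M \<and> mzero M \<in> N
     \<and> (\<forall>x\<in>N. \<forall>y\<in>N. madd M x y \<in> N) \<and> (\<forall>a. \<forall>x\<in>N. msmult M a x \<in> N)"

text \<open>The elements of a quotient module are the cosets \<open>x + N\<close>.\<close>

definition quotient_module :: "('r::ring_1, 'm) lmod \<Rightarrow> 'm set \<Rightarrow> ('r, 'm set) lmod" where
  "quotient_module M N =
     \<lparr>mcarrier = (\<lambda>x. madd M x ` N) ` mcarrier M,
      madd = (\<lambda>A B. {madd M x y | x y. x \<in> A \<and> y \<in> B}),
      mzero = N,
      msmult = (\<lambda>a A. {madd M (msmult M a x) y | x y. x \<in> A \<and> y \<in> N})\<rparr>"

definition module_isomorphic :: "('r::ring_1, 'm) lmod \<Rightarrow> ('r, 'n) lmod \<Rightarrow> bool" where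
  "module_isomorphic M N \<longleftrightarrow> (\<exists>f. bij_betw f (mcarrier M) (mcarrier N)
     \<and> (\<forall>x\<in>mcarrier M. \<forall>y\<in>mcarrier M. f (madd M x y) = madd N (f x) (f y))
     \<and> (\<forall>a. \<forall>x\<in>mcarrier M. f (msmult M a x) = msmult N a (f x)))"

text \<open>
  For a set \<open>S\<close> of modules with elements in \<open>'m\<close>, \<open>S // module_iso_rel\<close> is the set of isomorphism
  classes of the members of \<open>S\<close>, each class taken among all modules with elements in \<open>'m\<close>.
\<close>

definition module_iso_rel :: "(('r::ring_1, 'm) lmod \<times> ('r, 'm) lmod) set" where
  "module_iso_rel = {(M, N). left_module M \<and> left_module N \<and> module_isomorphic M N}"

text \<open>For a left ideal \<open>I\<close>, the additive group generated by the products \<open>a m\<close> is already a submodule.\<close>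

definition ideal_smult :: "'r set \<Rightarrow> ('r::ring_1, 'm) lmod \<Rightarrow> 'm set" where
  "ideal_smult I M = \<Inter>{N. submodule N M \<and> (\<forall>a\<in>I. \<forall>x\<in>mcarrier M. msmult M a x \<in> N)}"

definition regular_module :: "('r::ring_1, 'r) lmod" where
  "regular_module = \<lparr>mcarrier = UNIV, madd = (+), mzero = 0, msmult = (*)\<rparr>"

definition left_ideal_module :: "'r::ring_1 set \<Rightarrow> ('r, 'r) lmod" where
  "left_ideal_module I = regular_module\<lparr>mcarrier := I\<rparr>"

definition maximal_left_ideal :: "'r::ring_1 set \<Rightarrow> bool" where
  "maximal_left_ideal I \<longleftrightarrow> submodule I regular_module \<and> I \<noteq> UNIV
     \<and> (\<forall>L. submodule L regular_module \<and> I \<subseteq> L \<longrightarrow> L = I \<or> L = UNIV)"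

definition jacobson_radical :: "'r::ring_1 set" where
  "jacobson_radical = \<Inter>{I. maximal_left_ideal I}"

fun rad_pow :: "nat \<Rightarrow> 'r::ring_1 set" where
  "rad_pow 0 = UNIV"
| "rad_pow (Suc d) = ideal_smult jacobson_radical (left_ideal_module (rad_pow d))"

definition primitive_idempotent :: "'r::ring_1 \<Rightarrow> bool" where
  "primitive_idempotent x \<longleftrightarrow> x * x = x \<and> x \<noteq> 0
     \<and> \<not> (\<exists>f g. f * f = f \<and> g * g = g \<and> f * g = 0 \<and> g * f = 0
             \<and> f \<noteq> 0 \<and> g \<noteq> 0 \<and> x = f + g)"

definition complete_primitive_orthogonal :: "nat \<Rightarrow> (nat \<Rightarrow> 'r::ring_1) \<Rightarrow> bool" where
  "complete_primitive_orthogonal t e \<longleftrightarrow> (\<forall>h\<in>{1..t}. primitive_idempotent (e h))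
     \<and> (\<forall>h\<in>{1..t}. \<forall>l\<in>{1..t}. h \<noteq> l \<longrightarrow> e h * e l = 0) \<and> (\<Sum>h=1..t. e h) = 1"

definition proj_module :: "'r::ring_1 \<Rightarrow> ('r, 'r) lmod" where
  "proj_module x = left_ideal_module {a * x | a. True}"

definition basic_algebra :: "nat \<Rightarrow> (nat \<Rightarrow> 'r::ring_1) \<Rightarrow> bool" where
  "basic_algebra t e \<longleftrightarrow> (\<forall>h\<in>{1..t}. \<forall>l\<in>{1..t}. h \<noteq> l
     \<longrightarrow> \<not> module_isomorphic (proj_module (e h)) (proj_module (e l)))"

definition corner :: "'r::ring_1 \<Rightarrow> 'r set \<Rightarrow> 'r \<Rightarrow> 'r set" where
  "corner x A y = {x * a * y | a. a \<in> A}"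

text \<open>
  \<open>D = x \<Lambda> x / x J x\<close> is the set of cosets \<open>a + x J x\<close> with the operations induced from
  representatives, and \<open>\<phi>\<close> is an isomorphism of \<open>k\<close>-algebras from \<open>D\<close> to \<open>k\<close>.
\<close>

definition split_idempotent :: "('k::field \<Rightarrow> 'r::ring_1 \<Rightarrow> 'r) \<Rightarrow> 'r \<Rightarrow> bool" where
  "split_idempotent scale x \<longleftrightarrow>
     (let A = corner x UNIV x; N = corner x jacobson_radical x in
      \<exists>\<phi> :: 'r set \<Rightarrow> 'k. bij_betw \<phi> ((\<lambda>a. a +o N) ` A) UNIV
        \<and> (\<forall>a\<in>A. \<forall>b\<in>A. \<phi> ((a + b) +o N) = \<phi> (a +o N) + \<phi> (b +o N))
        \<and> (\<forall>a\<in>A. \<forall>b\<in>A. \<phi> ((a * b) +o N) = \<phi> (a +o N) * \<phi> (b +o N))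
        \<and> (\<forall>c. \<forall>a\<in>A. \<phi> (scale c a +o N) = c * \<phi> (a +o N))
        \<and> \<phi> (x +o N) = 1)"

definition split_algebra :: "('k::field \<Rightarrow> 'r::ring_1 \<Rightarrow> 'r) \<Rightarrow> nat \<Rightarrow> (nat \<Rightarrow> 'r) \<Rightarrow> bool" where
  "split_algebra scale t e \<longleftrightarrow> (\<forall>h\<in>{1..t}. split_idempotent scale (e h))"

definition V_space :: "(nat \<Rightarrow> 'r::ring_1) \<Rightarrow> nat \<Rightarrow> nat \<Rightarrow> nat \<Rightarrow> 'r set" where
  "V_space e n i j = corner (e j) (rad_pow (n - 1)) (e i)"

text \<open>
  The sum over \<open>h\<close>, and the sum \<open>W + U\<close> below, are sums of subsets as in \<open>Set_Algebras\<close>;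
  they are direct because the \<open>e h\<close> are orthogonal.
\<close>

definition W_space :: "(nat \<Rightarrow> 'r::ring_1) \<Rightarrow> nat \<Rightarrow> nat \<Rightarrow> nat \<Rightarrow> nat \<Rightarrow> 'r set" where
  "W_space e t n i j =
     (\<Sum>h\<in>{1..t} - {j}. e h *o ideal_smult (rad_pow (n - 1)) (proj_module (e i)))"

definition terminal_completion ::
    "(nat \<Rightarrow> 'r::ring_1) \<Rightarrow> nat \<Rightarrow> nat \<Rightarrow> nat \<Rightarrow> nat \<Rightarrow> 'r set \<Rightarrow> ('r, 'r set) lmod" where
  "terminal_completion e t n i j U =
     quotient_module (proj_module (e i)) (W_space e t n i j + U)"

definition codim_subspaces ::
    "('k::field \<Rightarrow> 'r::ring_1 \<Rightarrow> 'r) \<Rightarrow> 'r set \<Rightarrow> nat \<Rightarrow> 'r set set" where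
  "codim_subspaces scale V s = {U. module.subspace scale U \<and> U \<subseteq> V
     \<and> vector_space.dim scale U + s = vector_space.dim scale V}"

definition terminal_completions ::
    "('k::field \<Rightarrow> 'r::ring_1 \<Rightarrow> 'r) \<Rightarrow> (nat \<Rightarrow> 'r) \<Rightarrow> nat \<Rightarrow> nat \<Rightarrow> nat \<Rightarrow> nat \<Rightarrow> nat
      \<Rightarrow> ('r, 'r set) lmod set" where
  "terminal_completions scale e t n i j s =
     terminal_completion e t n i j ` codim_subspaces scale (V_space e n i j) s"

definition has_proper_radical_tower ::
    "(nat \<Rightarrow> 'r::ring_1) \<Rightarrow> nat \<Rightarrow> nat \<Rightarrow> ('r, 'm) lmod \<Rightarrow> bool" where
  "has_proper_radical_tower e n i M \<longleftrightarrow> (\<forall>d. 1 \<le> d \<and> d < n \<longrightarrow>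
     module_isomorphic (quotient_module M (ideal_smult (rad_pow d) M))
       (quotient_module (proj_module (e i)) (ideal_smult (rad_pow d) (proj_module (e i)))))"

definition F_classes ::
    "('k::field \<Rightarrow> 'r::ring_1 \<Rightarrow> 'r) \<Rightarrow> (nat \<Rightarrow> 'r) \<Rightarrow> nat \<Rightarrow> nat \<Rightarrow> nat \<Rightarrow> nat \<Rightarrow> nat
      \<Rightarrow> ('r, 'r set) lmod set set" where
  "F_classes scale e t n i j s = terminal_completions scale e t n i j s // module_iso_rel"

definition gauss_binomial :: "nat \<Rightarrow> nat \<Rightarrow> nat \<Rightarrow> real" where
  "gauss_binomial q m s =
     (\<Prod>r<s. (real q ^ (m - r) - 1) / (real q ^ (s - r) - 1))"

end

theory Submission
  imports Defs
begin

text \<open>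
  Write \<open>P = \<Lambda> e\<^sub>i\<close>, \<open>N = n - 1\<close>, and \<open>K\<^sub>U = W + U\<close>, so that \<open>M\<^sub>U = P/K\<^sub>U\<close>. The theorem amounts to three facts:
  every \<open>M\<^sub>U\<close> has the prescribed tower, different \<open>U\<close> give non-isomorphic \<open>M\<^sub>U\<close>, and the subspaces of
  codimension \<open>s\<close> in \<open>V\<close> are counted by the Gaussian binomial.

  Everything rests on the equations \<open>J L = 0\<close> and \<open>L J = 0\<close> for the terminal layer \<open>L = J\<^sup>N P\<close>, which hold
  because \<open>J\<^sup>n = 0\<close>. As \<open>\<Lambda>\<close> is basic and split, \<open>e\<^sub>h \<Lambda> e\<^sub>l \<subseteq> J\<close> for \<open>h \<noteq> l\<close>
  (\<open>corner_subset_jacobson_radical\<close>) and \<open>e\<^sub>h \<Lambda> e\<^sub>h = k e\<^sub>h + e\<^sub>h J e\<^sub>h\<close> (\<open>split_idempotent_decomp\<close>). Hence, in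
  its action on the terminal layer, \<open>\<Lambda>\<close> is reduced to the scalars \<open>k e\<^sub>1, \<dots>, k e\<^sub>t\<close>; any subspace \<open>U\<close> of
  \<open>V = e\<^sub>j L\<close> thus gives a submodule \<open>K\<^sub>U = {x \<in> L. e\<^sub>j x \<in> U}\<close> (\<open>kernel_eq\<close>, \<open>kernel_submodule\<close>).

  The tower: for \<open>d < n\<close> the submodule \<open>K\<^sub>U\<close> lies in \<open>J\<^sup>d P\<close>, so dividing by it first does not change the
  quotient by \<open>J\<^sup>d\<close> (\<open>quotient_mod_ideal_smult\<close>).

  The isomorphism classes: an isomorphism \<open>M\<^sub>U \<cong> M\<^bsub>U'\<^esub>\<close> is induced by right multiplication by an element
  of \<open>e\<^sub>i \<Lambda> e\<^sub>i = k e\<^sub>i + e\<^sub>i J e\<^sub>i\<close>, which acts on the terminal layer as a scalar \<open>c\<close>. This scalar is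
  non-zero because \<open>U\<close> is a proper subspace of \<open>V\<close>, so \<open>U \<subseteq> U'\<close>, with equality by dimension
  (\<open>terminal_completion_iso_imp_subset\<close>).

  The count compares ordered bases: a space of dimension \<open>m\<close> has \<open>(q\<^sup>m - 1) (q\<^sup>m - q) \<dots> (q\<^sup>m - q\<^bsup>d-1\<^esup>)\<close>
  lists of \<open>d\<close> independent vectors, and each subspace of dimension \<open>d\<close> is the span of as many of them as
  the same formula gives for \<open>m = d\<close> (\<open>card_subspaces_of_dim\<close>).
\<close>

section \<open>Modules and their quotients\<close>

context left_module
begin

lemma madd_left_commute:
  assumes "x \<in> mcarrier M" "y \<in> mcarrier M" "z \<in> mcarrier M"
  shows "madd M x (madd M y z) = madd M y (madd M x z)"
  using assms by (simp add: add_assoc[symmetric] add_commute[of x y])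

lemma madd_left_cancel:
  assumes "x \<in> mcarrier M" "y \<in> mcarrier M" "z \<in> mcarrier M" and "madd M x y = madd M x z"
  shows "y = z"
proof -
  obtain w where w: "w \<in> mcarrier M" "madd M x w = mzero M"
    using add_inverse assms(1) by blast
  have "madd M w (madd M x v) = v" if "v \<in> mcarrier M" for v
    using assms(1) w that add_assoc[of w x v] add_commute[of w x] zero_add by simp
  from this[OF assms(2)] this[OF assms(3)] show ?thesis
    unfolding assms(4) by (rule trans[OF sym])
qed

lemma add_zero: "x \<in> mcarrier M \<Longrightarrow> madd M x (mzero M) = x"
  using add_commute zero_add zero_closed by simp

lemma smult_zero_left: "x \<in> mcarrier M \<Longrightarrow> msmult M 0 x = mzero M"
  using smult_add_left[of x 0 0] smult_closed[of x 0] zero_closed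
    madd_left_cancel[of "msmult M 0 x" "msmult M 0 x" "mzero M"] zero_add[of "msmult M 0 x"]
    add_commute[of "mzero M" "msmult M 0 x"]
  by simp

lemma add_uminus: "x \<in> mcarrier M \<Longrightarrow> madd M x (msmult M (- 1) x) = mzero M"
  using smult_add_left[of x 1 "- 1"] by (simp add: smult_one smult_zero_left)

lemma submodule_self: "submodule (mcarrier M) M"
  using zero_closed add_closed smult_closed by (simp add: submodule_def)

lemma ideal_smult_submodule: "submodule (ideal_smult I M) M"
  using submodule_self smult_closed unfolding ideal_smult_def submodule_def by blast

end

lemma smult_in_ideal_smult: "a \<in> I \<Longrightarrow> x \<in> mcarrier M \<Longrightarrow> msmult M a x \<in> ideal_smult I M"
  unfolding ideal_smult_def by blast

lemma ideal_smult_least: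
  assumes "submodule N M" and "\<And>a x. a \<in> I \<Longrightarrow> x \<in> mcarrier M \<Longrightarrow> msmult M a x \<in> N"
  shows "ideal_smult I M \<subseteq> N"
  using assms unfolding ideal_smult_def by blast

definition surj_hom :: "('m \<Rightarrow> 'p) \<Rightarrow> ('r::ring_1, 'm) lmod \<Rightarrow> ('r, 'p) lmod \<Rightarrow> bool" where
  "surj_hom f M N \<longleftrightarrow> f ` mcarrier M = mcarrier N \<and> f (mzero M) = mzero N
     \<and> (\<forall>x\<in>mcarrier M. \<forall>y\<in>mcarrier M. f (madd M x y) = madd N (f x) (f y))
     \<and> (\<forall>a. \<forall>x\<in>mcarrier M. f (msmult M a x) = msmult N a (f x))"

lemma surj_hom_closed: "surj_hom f M N \<Longrightarrow> x \<in> mcarrier M \<Longrightarrow> f x \<in> mcarrier N"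
  and surj_hom_zero: "surj_hom f M N \<Longrightarrow> f (mzero M) = mzero N"
  and surj_hom_add: "surj_hom f M N \<Longrightarrow> x \<in> mcarrier M \<Longrightarrow> y \<in> mcarrier M
        \<Longrightarrow> f (madd M x y) = madd N (f x) (f y)"
  and surj_hom_smult: "surj_hom f M N \<Longrightarrow> x \<in> mcarrier M \<Longrightarrow> f (msmult M a x) = msmult N a (f x)"
  unfolding surj_hom_def by blast+

lemma surj_homE:
  assumes "surj_hom f M N" and "y \<in> mcarrier N"
  obtains x where "x \<in> mcarrier M" "y = f x"
  using assms unfolding surj_hom_def by blast

lemma surj_hom_comp:
  assumes "surj_hom f M N" and "surj_hom g N L"
  shows "surj_hom (g \<circ> f) M L"
proof -
  have "(g \<circ> f) ` mcarrier M = mcarrier L"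
    using assms unfolding surj_hom_def by (metis image_comp)
  moreover have "\<forall>x\<in>mcarrier M. f x \<in> mcarrier N"
    using surj_hom_closed[OF assms(1)] by blast
  ultimately show ?thesis
    using assms unfolding surj_hom_def by simp
qed

text \<open>All module axioms are equations or solvability statements, so they pass to images.\<close>

lemma left_module_surj_hom:
  assumes "left_module M" and f: "surj_hom f M N"
  shows "left_module N"
proof -
  interpret left_module M by fact
  note [simp] = surj_hom_zero[OF f, symmetric] surj_hom_add[OF f, symmetric]
    surj_hom_smult[OF f, symmetric] surj_hom_closed[OF f] zero_closed add_closed smult_closed
  show ?thesis
  proof
    fix x assume "x \<in> mcarrier N"
    then obtain x' where x': "x' \<in> mcarrier M" "x = f x'" by (rule surj_homE[OF f])
    then obtain y' where "y' \<in> mcarrier M" "madd M x' y' = mzero M" using add_inverse by blast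
    then show "\<exists>y\<in>mcarrier N. madd N x y = mzero N"
      using x' by (intro bexI[of _ "f y'"]) simp_all
  qed (auto elim!: surj_homE[OF f] simp: add_assoc zero_add smult_add_left smult_add_right
      smult_smult smult_one add_commute[THEN arg_cong[of _ _ f]])
qed

definition coset_of :: "('r::ring_1, 'm) lmod \<Rightarrow> 'm set \<Rightarrow> 'm \<Rightarrow> 'm set" where
  "coset_of M N x = madd M x ` N"

context left_module
begin

context
  fixes N
  assumes N: "submodule N M"
begin

lemma submodule_closed:
  "mzero M \<in> N" "x \<in> N \<Longrightarrow> x \<in> mcarrier M" "x \<in> N \<Longrightarrow> msmult M a x \<in> N"
  "x \<in> N \<Longrightarrow> y \<in> N \<Longrightarrow> madd M x y \<in> N"
  using N by (auto simp: submodule_def)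

lemma coset_of_self: "x \<in> mcarrier M \<Longrightarrow> x \<in> coset_of M N x"
  unfolding coset_of_def by (rule image_eqI[of _ _ "mzero M"]) (simp_all add: submodule_closed(1) add_zero)

lemma coset_of_eq_iff:
  assumes x: "x \<in> mcarrier M" and y: "y \<in> mcarrier M"
  shows "coset_of M N x = coset_of M N y \<longleftrightarrow> (\<exists>u\<in>N. x = madd M y u)"
proof
  assume "coset_of M N x = coset_of M N y"
  moreover have "x \<in> coset_of M N x"
    by (rule coset_of_self[OF x])
  ultimately show "\<exists>u\<in>N. x = madd M y u"
    unfolding coset_of_def by auto
next
  assume "\<exists>u\<in>N. x = madd M y u"
  then obtain u where u: "u \<in> N" "x = madd M y u" by blast
  note uM = submodule_closed(2)[OF u(1)]
  have "madd M x v = madd M y (madd M u v)" if "v \<in> N" for v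
    using u(2) y uM submodule_closed(2)[OF that] by (simp add: add_assoc)
  moreover have "madd M y v = madd M x (madd M (msmult M (- 1) u) v)" if "v \<in> N" for v
  proof -
    note vM = submodule_closed(2)[OF that] and mu = smult_closed[OF uM, of "- 1"]
    have "madd M x (madd M (msmult M (- 1) u) v) = madd M y (madd M (madd M u (msmult M (- 1) u)) v)"
      using u(2) y uM vM mu by (simp add: add_assoc add_closed)
    then show ?thesis using uM vM by (simp add: add_uminus zero_add)
  qed
  ultimately show "coset_of M N x = coset_of M N y"
    unfolding coset_of_def using u(1) submodule_closed(3,4) by (auto intro!: image_eqI)
qed

lemma coset_of_eq_zero_iff:
  assumes "x \<in> mcarrier M"
  shows "coset_of M N x = coset_of M N (mzero M) \<longleftrightarrow> x \<in> N"
  using coset_of_eq_iff[OF assms zero_closed] submodule_closed(2) zero_add by auto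

lemma surj_hom_coset_of: "surj_hom (coset_of M N) M (quotient_module M N)"
proof -
  have "coset_of M N (mzero M) = N"
    unfolding coset_of_def using submodule_closed(2) zero_add by (auto intro!: image_eqI)
  moreover have "coset_of M N (madd M x y)
      = {madd M v w | v w. v \<in> coset_of M N x \<and> w \<in> coset_of M N y}"
    if x: "x \<in> mcarrier M" and y: "y \<in> mcarrier M" for x y
  proof -
    have "madd M (madd M x y) u = madd M x (madd M y u)" if "u \<in> N" for u
      using x y submodule_closed(2)[OF that] by (rule add_assoc)
    moreover have "madd M (madd M x u) (madd M y v) = madd M (madd M x y) (madd M u v)"
      if "u \<in> N" "v \<in> N" for u v
      using x y submodule_closed(2)[OF that(1)] submodule_closed(2)[OF that(2)]
      by (simp add: add_assoc add_closed madd_left_commute)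
    ultimately show ?thesis
      using coset_of_self[OF x] submodule_closed(4) unfolding coset_of_def by (fast intro: image_eqI)
  qed
  moreover have "coset_of M N (msmult M a x)
      = {madd M (msmult M a v) w | v w. v \<in> coset_of M N x \<and> w \<in> N}"
    if x: "x \<in> mcarrier M" for a x
  proof -
    have "madd M (msmult M a (madd M x u)) v
        = madd M (msmult M a x) (madd M (msmult M a u) v)" if "u \<in> N" "v \<in> N" for u v
      using x submodule_closed(2)[OF that(1)] submodule_closed(2)[OF that(2)]
      by (simp add: add_assoc smult_add_right smult_closed)
    then show ?thesis
      using coset_of_self[OF x] submodule_closed(3,4) unfolding coset_of_def by (fast intro: image_eqI)
  qed
  ultimately show ?thesis
    unfolding surj_hom_def quotient_module_def by (simp add: coset_of_def)
qed

lemma left_module_quotient: "left_module (quotient_module M N)"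
  using left_module_surj_hom[OF left_module_axioms surj_hom_coset_of] .

end

text \<open>
  First isomorphism theorem. The inverse isomorphism is the more convenient one to write down: the
  fibres of \<open>f\<close> are the cosets of its kernel.
\<close>

lemma first_isomorphism:
  assumes f: "surj_hom f M N" and K: "submodule K M"
    and ker: "\<And>x. x \<in> mcarrier M \<Longrightarrow> f x = mzero N \<longleftrightarrow> x \<in> K"
  shows "module_isomorphic N (quotient_module M K)"
proof -
  interpret N: left_module N
    using left_module_surj_hom[OF left_module_axioms f] .
  note Kc = submodule_closed[OF K] and pi = surj_hom_coset_of[OF K]
  define g where "g y = {x \<in> mcarrier M. f x = y}" for y
  have fibre: "f x = f y \<longleftrightarrow> (\<exists>u\<in>K. x = madd M y u)"
    if x: "x \<in> mcarrier M" and y: "y \<in> mcarrier M" for x y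
  proof
    assume eq: "f x = f y"
    let ?u = "madd M x (msmult M (- 1) y)"
    have u: "?u \<in> mcarrier M" using x y add_closed smult_closed by simp
    have "f ?u = madd N (f y) (msmult N (- 1) (f y))"
      using eq x y by (simp add: surj_hom_add[OF f] surj_hom_smult[OF f] smult_closed)
    then have "?u \<in> K"
      using ker[OF u] N.add_uminus surj_hom_closed[OF f y] by simp
    moreover have "x = madd M y ?u"
      using x y by (metis add_assoc add_commute add_uminus smult_closed zero_add)
    ultimately show "\<exists>u\<in>K. x = madd M y u" by blast
  next
    assume "\<exists>u\<in>K. x = madd M y u"
    then obtain u where u: "u \<in> K" "x = madd M y u" by blast
    then have "f x = madd N (f y) (mzero N)"
      using y Kc(2) ker by (metis surj_hom_add[OF f])
    then show "f x = f y"
      using surj_hom_closed[OF f y] by (simp add: N.add_commute N.zero_add N.zero_closed)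
  qed
  have g: "g (f y) = coset_of M K y" if y: "y \<in> mcarrier M" for y
    unfolding g_def coset_of_def using y Kc(2) fibre add_closed by auto
  have "bij_betw g (mcarrier N) (mcarrier (quotient_module M K))"
  proof (rule bij_betw_imageI)
    show "inj_on g (mcarrier N)"
    proof (rule inj_onI)
      fix y z assume "y \<in> mcarrier N" "z \<in> mcarrier N" and eq: "g y = g z"
      then obtain y' z' where "y' \<in> mcarrier M" "y = f y'" "z' \<in> mcarrier M" "z = f z'"
        by (metis surj_homE[OF f])
      then show "y = z" using eq g fibre coset_of_eq_iff[OF K] by simp
    qed
    have "g ` mcarrier N = coset_of M K ` mcarrier M"
      using f g unfolding surj_hom_def by (metis (no_types, lifting) image_cong image_image)
    then show "g ` mcarrier N = mcarrier (quotient_module M K)"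
      using pi unfolding surj_hom_def by simp
  qed
  moreover have "g (madd N y z) = madd (quotient_module M K) (g y) (g z)"
    if "y \<in> mcarrier N" "z \<in> mcarrier N" for y z
    using that g surj_hom_add[OF f] surj_hom_add[OF pi] add_closed by (metis surj_homE[OF f])
  moreover have "g (msmult N a y) = msmult (quotient_module M K) a (g y)"
    if "y \<in> mcarrier N" for a y
    using that g surj_hom_smult[OF f] surj_hom_smult[OF pi] smult_closed by (metis surj_homE[OF f])
  ultimately show ?thesis
    unfolding module_isomorphic_def by blast
qed

text \<open>Both inclusions use that \<open>I M\<close> is the least submodule containing the products: images
  and preimages of submodules are submodules.\<close>

lemma ideal_smult_surj_hom:
  assumes f: "surj_hom f M N"
  shows "ideal_smult I N = f ` ideal_smult I M"
proof
  interpret N: left_module N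
    using left_module_surj_hom[OF left_module_axioms f] .
  note IM = ideal_smult_submodule[of I]
  note IMc = submodule_closed[OF IM]
  have "submodule (f ` ideal_smult I M) N"
    unfolding submodule_def
  proof (intro conjI ballI allI)
    show "f ` ideal_smult I M \<subseteq> mcarrier N" using IMc(2) surj_hom_closed[OF f] by blast
    show "mzero N \<in> f ` ideal_smult I M" using IMc(1) surj_hom_zero[OF f] by (metis imageI)
    fix x assume "x \<in> f ` ideal_smult I M"
    then obtain x' where x: "x' \<in> ideal_smult I M" "x = f x'" by blast
    show "msmult N a x \<in> f ` ideal_smult I M" for a
      using x IMc(2,3) by (metis imageI surj_hom_smult[OF f])
    fix y assume "y \<in> f ` ideal_smult I M"
    then obtain y' where y: "y' \<in> ideal_smult I M" "y = f y'" by blast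
    show "madd N x y \<in> f ` ideal_smult I M"
      using x y IMc(2,4) by (metis imageI surj_hom_add[OF f])
  qed
  then show "ideal_smult I N \<subseteq> f ` ideal_smult I M"
  proof (rule ideal_smult_least)
    fix a y assume "a \<in> I" "y \<in> mcarrier N"
    then show "msmult N a y \<in> f ` ideal_smult I M"
      by (metis imageI smult_in_ideal_smult surj_homE[OF f] surj_hom_smult[OF f])
  qed
  note INc = N.submodule_closed[OF N.ideal_smult_submodule[of I]]
  have "submodule {x \<in> mcarrier M. f x \<in> ideal_smult I N} M"
    unfolding submodule_def
    using INc zero_closed add_closed smult_closed
    by (simp add: surj_hom_zero[OF f] surj_hom_add[OF f] surj_hom_smult[OF f] subset_iff)
  then have "ideal_smult I M \<subseteq> {x \<in> mcarrier M. f x \<in> ideal_smult I N}"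
  proof (rule ideal_smult_least)
    fix a x assume "a \<in> I" "x \<in> mcarrier M"
    then show "msmult M a x \<in> {x \<in> mcarrier M. f x \<in> ideal_smult I N}"
      using smult_closed surj_hom_closed[OF f]
      by (simp add: smult_in_ideal_smult surj_hom_smult[OF f])
  qed
  then show "f ` ideal_smult I M \<subseteq> ideal_smult I N" by blast
qed

text \<open>Passing from \<open>M\<close> to \<open>M/K\<close> is invisible modulo \<open>I M\<close> as long as \<open>K\<close> lies in \<open>I M\<close>: both
  sides are the image of \<open>M\<close> under a surjection with kernel \<open>I M\<close>.\<close>

lemma quotient_mod_ideal_smult:
  assumes K: "submodule K M" and sub: "K \<subseteq> ideal_smult I M"
  shows "module_isomorphic
      (quotient_module (quotient_module M K) (ideal_smult I (quotient_module M K)))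
      (quotient_module M (ideal_smult I M))"
proof -
  let ?Q = "quotient_module M K"
  let ?IQ = "ideal_smult I ?Q"
  note pi = surj_hom_coset_of[OF K]
  interpret Q: left_module ?Q
    using left_module_quotient[OF K] .
  note rho = Q.surj_hom_coset_of[OF Q.ideal_smult_submodule[of I]]
  note IM = ideal_smult_submodule[of I]
  show ?thesis
  proof (rule first_isomorphism[OF surj_hom_comp[OF pi rho] IM])
    fix x assume x: "x \<in> mcarrier M"
    have "(coset_of ?Q ?IQ \<circ> coset_of M K) x = mzero (quotient_module ?Q ?IQ)
        \<longleftrightarrow> coset_of M K x \<in> ?IQ"
      using Q.coset_of_eq_zero_iff[OF Q.ideal_smult_submodule[of I] surj_hom_closed[OF pi x]]
        surj_hom_zero[OF rho] by simp
    also have "\<dots> \<longleftrightarrow> (\<exists>y\<in>ideal_smult I M. coset_of M K x = coset_of M K y)"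
      unfolding ideal_smult_surj_hom[OF pi] by blast
    also have "\<dots> \<longleftrightarrow> x \<in> ideal_smult I M"
      using coset_of_eq_iff[OF K x] submodule_closed(2,4)[OF IM] sub by blast
    finally show "(coset_of ?Q ?IQ \<circ> coset_of M K) x = mzero (quotient_module ?Q ?IQ)
        \<longleftrightarrow> x \<in> ideal_smult I M" .
  qed
qed

end

section \<open>Powers of the radical\<close>

abbreviation left_ideal :: "'r::ring_1 set \<Rightarrow> bool" where
  "left_ideal I \<equiv> submodule I regular_module"

lemma left_ideal_iff:
  "left_ideal I \<longleftrightarrow> 0 \<in> I \<and> (\<forall>x\<in>I. \<forall>y\<in>I. x + y \<in> I) \<and> (\<forall>a. \<forall>x\<in>I. a * x \<in> I)"
  by (simp add: submodule_def regular_module_def)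

lemma left_ideal_closed:
  "left_ideal I \<Longrightarrow> 0 \<in> I" "left_ideal I \<Longrightarrow> x \<in> I \<Longrightarrow> y \<in> I \<Longrightarrow> x + y \<in> I"
  "left_ideal I \<Longrightarrow> x \<in> I \<Longrightarrow> a * x \<in> I"
  by (simp_all add: left_ideal_iff)

lemma left_ideal_uminus: "left_ideal I \<Longrightarrow> x \<in> I \<Longrightarrow> - x \<in> I"
  using left_ideal_closed(3)[of I x "- 1"] by simp

lemma left_ideal_sum: "left_ideal I \<Longrightarrow> (\<And>h. h \<in> A \<Longrightarrow> f h \<in> I) \<Longrightarrow> sum f A \<in> I"
  by (induction A rule: infinite_finite_induct) (auto simp: left_ideal_iff)

lemma left_ideal_mult_right_vimage:
  assumes "left_ideal I"
  shows "left_ideal {x. x * r \<in> I}"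
  unfolding left_ideal_iff using left_ideal_closed[OF assms] by (auto simp: distrib_right mult.assoc)

lemma left_ideal_module_simps [simp]:
  "mcarrier (left_ideal_module I) = I" "madd (left_ideal_module I) = (+)"
  "mzero (left_ideal_module I) = 0" "msmult (left_ideal_module I) = (*)"
  by (simp_all add: left_ideal_module_def regular_module_def)

lemma submodule_left_ideal_module:
  "submodule N (left_ideal_module I) \<longleftrightarrow> N \<subseteq> I \<and> left_ideal N"
  by (auto simp: submodule_def regular_module_def)

lemma left_module_left_ideal_module:
  assumes "left_ideal I"
  shows "left_module (left_ideal_module I)"
proof
  show "\<exists>y\<in>mcarrier (left_ideal_module I). madd (left_ideal_module I) x y = mzero (left_ideal_module I)"
    if "x \<in> mcarrier (left_ideal_module I)" for x
    using that left_ideal_uminus[OF assms] by (intro bexI[of _ "- x"]) simp_all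
qed (use assms in \<open>simp_all add: left_ideal_closed algebra_simps\<close>)

lemma left_ideal_ideal_smult:
  assumes "left_ideal I"
  shows "left_ideal (ideal_smult A (left_ideal_module I))" "ideal_smult A (left_ideal_module I) \<subseteq> I"
  using left_module.ideal_smult_submodule[OF left_module_left_ideal_module[OF assms], of A]
  by (simp_all add: submodule_left_ideal_module)

lemma jacobson_radical_left_ideal: "left_ideal jacobson_radical"
  unfolding jacobson_radical_def left_ideal_iff
  by (auto simp: maximal_left_ideal_def left_ideal_closed)

lemma rad_pow_left_ideal: "left_ideal (rad_pow d)"
  by (induction d) (simp_all add: left_ideal_ideal_smult, simp add: left_ideal_iff)

lemma mult_in_rad_pow_Suc: "a \<in> jacobson_radical \<Longrightarrow> x \<in> rad_pow d \<Longrightarrow> a * x \<in> rad_pow (Suc d)"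
  using smult_in_ideal_smult[of a jacobson_radical x "left_ideal_module (rad_pow d)"] by simp

lemma rad_pow_Suc_least:
  assumes "left_ideal N" and "\<And>a x. a \<in> jacobson_radical \<Longrightarrow> x \<in> rad_pow d \<Longrightarrow> a * x \<in> N"
  shows "rad_pow (Suc d) \<subseteq> N"
proof -
  have "submodule (N \<inter> rad_pow d) (left_ideal_module (rad_pow d))"
    using assms(1) rad_pow_left_ideal[of d] by (auto simp: submodule_left_ideal_module left_ideal_iff)
  then have "ideal_smult jacobson_radical (left_ideal_module (rad_pow d)) \<subseteq> N \<inter> rad_pow d"
    by (rule ideal_smult_least) (use assms(2) left_ideal_closed(3)[OF rad_pow_left_ideal] in auto)
  then show ?thesis by simp
qed

lemma rad_pow_antimono: "d \<le> d' \<Longrightarrow> rad_pow d' \<subseteq> rad_pow d"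
proof (induction d' rule: dec_induct)
  case (step d')
  then show ?case
    using left_ideal_ideal_smult(2)[OF rad_pow_left_ideal[of d']] by auto
qed simp

lemma rad_pow_mult_right: "x \<in> rad_pow d \<Longrightarrow> x * r \<in> rad_pow d"
proof (induction d arbitrary: x)
  case (Suc d)
  have "rad_pow (Suc d) \<subseteq> {x. x * r \<in> rad_pow (Suc d)}"
  proof (rule rad_pow_Suc_least)
    show "left_ideal {x. x * r \<in> rad_pow (Suc d)}"
      by (rule left_ideal_mult_right_vimage[OF rad_pow_left_ideal])
  qed (use Suc.IH in \<open>simp del: rad_pow.simps add: mult.assoc mult_in_rad_pow_Suc\<close>)
  then show ?case using Suc.prems by blast
qed simp

text \<open>The recursion for \<open>rad_pow\<close> adds factors of the radical on the left; they may equally be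
  added on the right.\<close>

lemma rad_pow_mult_jacobson:
  "x \<in> rad_pow d \<Longrightarrow> a \<in> jacobson_radical \<Longrightarrow> x * a \<in> rad_pow (Suc d)"
proof (induction d arbitrary: x)
  case 0
  then have "a * 1 \<in> rad_pow (Suc 0)"
    by (intro mult_in_rad_pow_Suc) simp_all
  then show ?case
    using left_ideal_closed(3)[OF rad_pow_left_ideal, of a "Suc 0" x] by simp
next
  case (Suc d)
  have "rad_pow (Suc d) \<subseteq> {x. x * a \<in> rad_pow (Suc (Suc d))}"
  proof (rule rad_pow_Suc_least)
    show "left_ideal {x. x * a \<in> rad_pow (Suc (Suc d))}"
      by (rule left_ideal_mult_right_vimage[OF rad_pow_left_ideal])
    show "b * x \<in> {x. x * a \<in> rad_pow (Suc (Suc d))}"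
      if "b \<in> jacobson_radical" "x \<in> rad_pow d" for b x
      using mult_in_rad_pow_Suc[OF that(1) Suc.IH[OF that(2) Suc.prems(2)]]
      by (simp del: rad_pow.simps add: mult.assoc)
  qed
  then show ?case using Suc.prems(1) by blast
qed

text \<open>The outer factors \<open>x\<close> and \<open>y\<close> are absorbed by the left ideals \<open>J\<^bsup>d+1\<^esup>\<close> and \<open>J\<^sup>d\<close>.\<close>

lemma corner_jacobson_mult:
  assumes "u \<in> corner x jacobson_radical y" and "z \<in> rad_pow d"
  shows "u * z \<in> rad_pow (Suc d)"
proof -
  obtain w where w: "w \<in> jacobson_radical" "u = x * w * y"
    using assms(1) by (auto simp: corner_def)
  have "x * (w * (y * z)) \<in> rad_pow (Suc d)"
    using w(1) assms(2) by (intro left_ideal_closed(3)[OF rad_pow_left_ideal] mult_in_rad_pow_Suc)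
  then show ?thesis
    by (simp only: w(2) mult.assoc)
qed

lemma corner_jacobson_power: "u \<in> corner x jacobson_radical y \<Longrightarrow> u ^ d \<in> rad_pow d"
proof (induction d)
  case (Suc d)
  then show ?case using corner_jacobson_mult[of u x y "u ^ d" d] by simp
qed simp

lemma left_ideal_principal: "left_ideal {a * x | a. True}"
  unfolding left_ideal_iff
  by (auto intro: exI[of _ 0] simp: distrib_right[symmetric] mult.assoc[symmetric])

lemma proj_module_simps [simp]:
  "mcarrier (proj_module x) = {a * x | a. True}" "madd (proj_module x) = (+)"
  "mzero (proj_module x) = 0" "msmult (proj_module x) = (*)"
  by (simp_all add: proj_module_def)

lemma left_module_proj_module: "left_module (proj_module x)"
  unfolding proj_module_def by (rule left_module_left_ideal_module[OF left_ideal_principal])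

text \<open>The right-hand side absorbs the products \<open>a (r x)\<close> because the powers of the radical are
  two-sided.\<close>

lemma ideal_smult_proj_module:
  fixes x :: "'r::ring_1"
  shows "ideal_smult (rad_pow d) (proj_module x) = {a * x | a. a \<in> rad_pow d}"
proof
  have "submodule {a * x | a. a \<in> rad_pow d} (proj_module x)"
    unfolding proj_module_def submodule_left_ideal_module left_ideal_iff
    using rad_pow_left_ideal[of d] unfolding left_ideal_iff
    by (auto simp: distrib_right[symmetric] mult.assoc[symmetric] intro: exI[of _ 0])
  then show "ideal_smult (rad_pow d) (proj_module x) \<subseteq> {a * x | a. a \<in> rad_pow d}"
  proof (rule ideal_smult_least)
    fix a :: 'r and y assume "a \<in> rad_pow d" "y \<in> mcarrier (proj_module x)"
    then obtain r where "y = r * x" "a * r \<in> rad_pow d" by (auto intro: rad_pow_mult_right)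
    then show "msmult (proj_module x) a y \<in> {a * x | a. a \<in> rad_pow d}"
      by (auto simp: mult.assoc[symmetric])
  qed
  show "{a * x | a. a \<in> rad_pow d} \<subseteq> ideal_smult (rad_pow d) (proj_module x)"
  proof clarify
    fix a :: 'r assume "a \<in> rad_pow d"
    moreover have "\<exists>b. x = b * x" by (rule exI[of _ 1]) simp
    ultimately show "a * x \<in> ideal_smult (rad_pow d) (proj_module x)"
      using smult_in_ideal_smult[of a "rad_pow d" x "proj_module x"] by simp
  qed
qed

section \<open>Basic split algebras\<close>

lemma geometric_sum_nilpotent:
  fixes v :: "'a::ring_1"
  assumes "v ^ n = 0"
  shows "(\<Sum>k<n. v ^ k) * (1 - v) = 1"
proof -
  have "(\<Sum>k<n. v ^ k) * (1 - v) = 1 - v ^ n" for n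
  proof (induction n)
    case (Suc n)
    have "(\<Sum>k<Suc n. v ^ k) * (1 - v) = (1 - v ^ n) + v ^ n * (1 - v)"
      by (simp add: distrib_right Suc)
    then show ?case by (simp add: right_diff_distrib power_commutes)
  qed simp
  then show ?thesis using assms by simp
qed

text \<open>Otherwise a maximal left ideal avoiding \<open>x\<close> would contain some \<open>1 - y x\<close>, which has a left inverse
  by the geometric series.\<close>

lemma in_jacobson_radicalI:
  assumes "\<And>y. \<exists>k. (y * x) ^ k = 0"
  shows "x \<in> jacobson_radical"
  unfolding jacobson_radical_def
proof (intro InterI, rule ccontr)
  fix I assume "I \<in> {I. maximal_left_ideal I}" and x: "x \<notin> I"
  then have I: "left_ideal I" "I \<noteq> UNIV"
    and max: "\<And>L. left_ideal L \<Longrightarrow> I \<subseteq> L \<Longrightarrow> L = I \<or> L = UNIV"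
    by (auto simp: maximal_left_ideal_def)
  \<comment> \<open>The left ideal generated by \<open>I\<close> and \<open>x\<close>.\<close>
  define L where "L = {y * x + z | y z. z \<in> I}"
  have "left_ideal L"
    unfolding left_ideal_iff
  proof (intro conjI ballI allI)
    show "0 \<in> L" unfolding L_def using left_ideal_closed(1)[OF I(1)] by (auto intro: exI[of _ 0])
    fix u assume "u \<in> L"
    then obtain y z where u: "z \<in> I" "u = y * x + z" unfolding L_def by blast
    show "a * u \<in> L" for a
      unfolding L_def using u left_ideal_closed(3)[OF I(1)]
      by (auto simp: distrib_left mult.assoc[symmetric])
    fix v assume "v \<in> L"
    then obtain y' z' where v: "z' \<in> I" "v = y' * x + z'" unfolding L_def by blast
    have "u + v = (y + y') * x + (z + z')" using u v by (simp add: algebra_simps)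
    then show "u + v \<in> L" unfolding L_def using u v left_ideal_closed(2)[OF I(1)] by blast
  qed
  moreover have "I \<subseteq> L" unfolding L_def by (auto intro: exI[of _ 0])
  moreover have "x \<in> L" unfolding L_def using left_ideal_closed(1)[OF I(1)]
    by (intro CollectI exI[of _ 1] exI[of _ 0]) simp
  ultimately have "1 \<in> L" using max x by blast
  then obtain y z where yz: "z \<in> I" "1 - y * x = z" unfolding L_def by (auto simp: diff_eq_eq add.commute)
  obtain k where "(y * x) ^ k = 0" using assms by blast
  then have "(\<Sum>i<k. (y * x) ^ i) * z = 1"
    using geometric_sum_nilpotent yz(2) by blast
  then have "1 \<in> I" using left_ideal_closed(3)[OF I(1) yz(1)] by metis
  then show False using I left_ideal_closed(3)[OF I(1), of 1] by auto
qed

text \<open>The isomorphism onto the field is injective and sends the coset of \<open>x\<close> to \<open>1\<close>, so every coset modulo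
  \<open>x J x\<close> contains a scalar multiple of \<open>x\<close>.\<close>

lemma split_idempotent_decomp:
  assumes "finite_dim_algebra scale" and "split_idempotent scale x" and "x * x = x"
  obtains c u where "x * a * x = scale c x + u" "u \<in> corner x jacobson_radical x"
proof -
  interpret finite_dim_algebra scale by fact
  let ?N = "corner x jacobson_radical x"
  let ?A = "corner x UNIV x"
  obtain \<phi> where \<phi>: "bij_betw \<phi> ((\<lambda>a. a +o ?N) ` ?A) UNIV"
      "\<forall>c. \<forall>a\<in>?A. \<phi> (scale c a +o ?N) = c * \<phi> (a +o ?N)" "\<phi> (x +o ?N) = 1"
    using assms(2) unfolding split_idempotent_def Let_def by blast
  have xA: "x \<in> ?A" and aA: "x * a * x \<in> ?A"
    unfolding corner_def using assms(3) by (auto intro: exI[of _ 1])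
  define c where "c = \<phi> (x * a * x +o ?N)"
  have "scale c x = x * scale c x * x"
    using assms(3) by (simp add: scale_mult_left scale_mult_right)
  then have cA: "scale c x \<in> ?A" unfolding corner_def by blast
  have "\<phi> (scale c x +o ?N) = \<phi> (x * a * x +o ?N)"
    using \<phi>(2,3) xA by (simp add: c_def)
  then have "scale c x +o ?N = x * a * x +o ?N"
    using bij_betw_imp_inj_on[OF \<phi>(1)] cA aA by (auto dest: inj_onD)
  moreover have "0 \<in> ?N"
    unfolding corner_def using left_ideal_closed(1)[OF jacobson_radical_left_ideal]
    by (auto intro: exI[of _ 0])
  then have "x * a * x \<in> x * a * x +o ?N" by (auto simp: elt_set_plus_def)
  ultimately have "x * a * x \<in> scale c x +o ?N" by simp
  then show thesis using that by (auto simp: elt_set_plus_def)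
qed

text \<open>
  For an element \<open>x = e x f\<close> outside the radical, some \<open>z x\<close> with \<open>z \<in> f \<Lambda> e\<close> has a non-zero
  component along \<open>f\<close> in \<open>f \<Lambda> f = k f + f J f\<close>, for otherwise every \<open>y x\<close> would be nilpotent.
  As \<open>f J f\<close> is nil, \<open>z\<close> can be corrected to a left inverse of \<open>x\<close>, in the sense that \<open>z x = f\<close>. Then
  \<open>x z\<close> is a non-zero idempotent of \<open>e \<Lambda> e\<close>, hence equal to \<open>e\<close> because \<open>e\<close> is primitive, and right
  multiplication by \<open>x\<close> is an isomorphism \<open>\<Lambda> e \<cong> \<Lambda> f\<close>.
\<close>

lemma corner_subset_jacobson_radical:
  fixes scale :: "'k::field \<Rightarrow> 'r::ring_1 \<Rightarrow> 'r" and x :: 'r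
  assumes alg: "finite_dim_algebra scale" and nil: "rad_pow n = ({0} :: 'r set)"
    and e: "primitive_idempotent e" and f: "f * f = f" "split_idempotent scale f"
    and niso: "\<not> module_isomorphic (proj_module e) (proj_module f)"
    and x: "e * x = x" "x * f = x"
  shows "x \<in> jacobson_radical"
proof (rule in_jacobson_radicalI, rule ccontr)
  interpret finite_dim_algebra scale by fact
  have ee: "e * e = e" using e by (simp add: primitive_idempotent_def)
  fix y assume not_nil: "\<nexists>k. (y * x) ^ k = 0"
  obtain c u where cu: "f * (y * x) * f = scale c f + u" and u: "u \<in> corner f jacobson_radical f"
    using split_idempotent_decomp[OF alg f(2,1), of "y * x"] by blast
  have fu: "f * u = u" "u * f = u"
    using u f(1) by (auto simp: corner_def mult.assoc) (simp add: mult.assoc[symmetric])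
  have xfx: "x * (y * x) = x * (f * (y * x) * f)"
    using x(2) by (simp add: mult.assoc) (simp add: mult.assoc[symmetric])
  \<comment> \<open>If \<open>c = 0\<close>, then \<open>x (y x) = x u\<close>, and the powers of \<open>y x\<close> vanish together with those of \<open>u\<close>.\<close>
  have "c \<noteq> 0"
  proof
    assume "c = 0"
    then have xyx: "x * (y * x) = x * u" using xfx cu by simp
    have "(y * x) ^ Suc k = y * x * u ^ k" for k
    proof (induction k)
      case (Suc k)
      have "(y * x) ^ Suc (Suc k) = y * (x * (y * x)) * u ^ k"
        using Suc by (simp add: mult.assoc)
      then show ?case by (simp add: xyx mult.assoc)
    qed simp
    from this[of n] have "(y * x) ^ Suc n = 0"
      using corner_jacobson_power[OF u, of n] nil by simp
    then show False using not_nil by blast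
  qed
  \<comment> \<open>Chosen so that \<open>f (y x) f = c (1 - v) f\<close>; the geometric series then inverts \<open>1 - v\<close>.\<close>
  define v where "v = scale (- inverse c) u"
  obtain w where w: "w \<in> jacobson_radical" "u = f * w * f"
    using u by (auto simp: corner_def)
  have "scale (- inverse c) w \<in> jacobson_radical"
    using left_ideal_closed(3)[OF jacobson_radical_left_ideal w(1), of "scale (- inverse c) 1"]
    by (simp add: scale_mult_left)
  moreover have "v = f * scale (- inverse c) w * f"
    by (simp add: v_def w(2) scale_mult_left scale_mult_right)
  ultimately have "v \<in> corner f jacobson_radical f"
    unfolding corner_def by blast
  then have v_nil: "v ^ n = 0"
    using corner_jacobson_power nil by blast
  define s where "s = (\<Sum>k<n. v ^ k)"
  define z where "z = f * s * scale (inverse c) (f * y) * e"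
  have "scale (inverse c) (f * y) * e * x = scale (inverse c) (f * (y * x) * f)"
    using x by (simp add: scale_mult_left mult.assoc)
  also have "\<dots> = (1 - v) * f"
    using \<open>c \<noteq> 0\<close> fu
    by (simp add: cu v_def scale_right_distrib distrib_right scale_mult_left)
  finally have "z * x = f * (s * (1 - v)) * f"
    by (simp add: z_def mult.assoc)
  then have zx: "z * x = f"
    using geometric_sum_nilpotent[OF v_nil] f(1) by (simp add: s_def)
  have ze: "z * e = z" by (simp add: z_def mult.assoc ee)
  define p where "p = x * z"
  have "p * p = x * (z * x) * z" by (simp add: p_def mult.assoc)
  then have p: "p * p = p" "e * p = p" "p * e = p"
    by (simp_all add: zx x p_def mult.assoc[symmetric]) (simp add: mult.assoc ze)
  have "p \<noteq> 0"
  proof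
    assume "p = 0"
    then have "x * (z * x) = 0" by (simp add: p_def mult.assoc[symmetric])
    then have "x = 0" using zx x by simp
    then have "(y * x) ^ 1 = 0" by simp
    then show False using not_nil by blast
  qed
  moreover have "p * p = p \<and> (e - p) * (e - p) = e - p \<and> p * (e - p) = 0 \<and> (e - p) * p = 0
      \<and> e = p + (e - p)"
    using p ee by (simp add: algebra_simps)
  ultimately have "e - p = 0"
    using e unfolding primitive_idempotent_def by blast
  then have xz: "x * z = e" by (simp add: p_def)
  have "bij_betw (\<lambda>a. a * x) {a * e |a. True} {a * f |a. True}"
  proof (rule bij_betw_byWitness[where f' = "\<lambda>b. b * z"])
    show "\<forall>a\<in>{a * e |a. True}. a * x * z = a" by (auto simp: mult.assoc xz ee)
    show "\<forall>b\<in>{a * f |a. True}. b * z * x = b" by (auto simp: mult.assoc zx f(1))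
    have "a * e * x = (a * x) * f" "a * f * z = (a * f * z) * e" for a
      using x ze by (simp_all add: mult.assoc)
    then show "(\<lambda>a. a * x) ` {a * e |a. True} \<subseteq> {a * f |a. True}"
      "(\<lambda>b. b * z) ` {a * f |a. True} \<subseteq> {a * e |a. True}" by blast+
  qed
  then have "module_isomorphic (proj_module e) (proj_module f)"
    unfolding module_isomorphic_def
    by (intro exI[of _ "\<lambda>a. a * x"]) (simp add: distrib_right mult.assoc)
  then show False using niso by blast
qed

section \<open>Counting subspaces over a finite field\<close>

context vector_space
begin

lemma span_insert_image: "span (insert b S) = (\<lambda>(k, y). k *s b + y) ` (UNIV \<times> span S)"
proof
  show "span (insert b S) \<subseteq> (\<lambda>(k, y). k *s b + y) ` (UNIV \<times> span S)"
  proof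
    fix x assume "x \<in> span (insert b S)"
    then obtain k where k: "x - k *s b \<in> span S" by (auto simp: span_breakdown_eq)
    then show "x \<in> (\<lambda>(k, y). k *s b + y) ` (UNIV \<times> span S)"
      by (intro image_eqI[of _ _ "(k, x - k *s b)"]) simp_all
  qed
  show "(\<lambda>(k, y). k *s b + y) ` (UNIV \<times> span S) \<subseteq> span (insert b S)"
  proof clarify
    fix k y assume "y \<in> span S"
    then show "k *s b + y \<in> span (insert b S)"
      by (auto simp: span_breakdown_eq intro!: exI[of _ k])
  qed
qed

context
  assumes finite_field: "finite (UNIV :: 'a set)"
begin

lemma finite_span: "finite B \<Longrightarrow> finite (span B)"
  by (induction B rule: finite_induct) (simp_all add: span_insert_image finite_field)

lemma card_span:
  assumes "finite B" and "independent B"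
  shows "card (span B) = CARD('a) ^ card B"
  using assms
proof (induction B rule: finite_induct)
  case (insert b B)
  then have b: "b \<notin> span B" "independent B" by (auto simp: independent_insert)
  have "inj_on (\<lambda>(k, y). k *s b + y) (UNIV \<times> span B)"
  proof (rule inj_onI, clarsimp)
    fix k y l z assume yz: "y \<in> span B" "z \<in> span B" and eq: "k *s b + y = l *s b + z"
    have *: "(k - l) *s b = z - y" using eq by (simp add: scale_left_diff_distrib algebra_simps)
    have "k = l"
    proof (rule ccontr)
      assume "k \<noteq> l"
      then have "b = inverse (k - l) *s (z - y)" by (simp flip: *)
      then show False using b(1) yz by (metis span_diff span_scale)
    qed
    then show "k = l \<and> y = z" using eq by simp
  qed
  then show ?case
    using insert b(2) by (simp add: span_insert_image card_image card_cartesian_product)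
qed simp

lemma card_subspace:
  assumes "subspace V" and "finite V"
  shows "card V = CARD('a) ^ dim V"
proof -
  obtain B where B: "B \<subseteq> V" "independent B" "V \<subseteq> span B" "card B = dim V"
    by (rule basis_exists)
  then have "span B = V" using span_subspace assms(1) by blast
  then show ?thesis using card_span[of B] B finite_subset[OF B(1) assms(2)] by simp
qed

lemma subspace_eqI:
  assumes "subspace U" "subspace V" "finite V" "U \<subseteq> V" "dim U = dim V"
  shows "U = V"
  using assms card_subspace[of U] card_subspace[of V] finite_subset[of U V]
  by (metis card_subset_eq)

definition indep_lists :: "'b set \<Rightarrow> nat \<Rightarrow> 'b list set" where
  "indep_lists V d = {xs. length xs = d \<and> distinct xs \<and> set xs \<subseteq> V \<and> independent (set xs)}"

lemma indep_lists_span: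
  assumes "subspace V" "finite V" "xs \<in> indep_lists V d"
  shows "span (set xs) \<subseteq> V" "card (span (set xs)) = CARD('a) ^ d" "dim (span (set xs)) = d"
  using assms card_span[of "set xs"] dim_eq_card_independent[of "set xs"]
  by (auto simp: indep_lists_def distinct_card span_minimal dim_span)

lemma finite_indep_lists: "finite V \<Longrightarrow> finite (indep_lists V d)"
  using finite_lists_length_eq[of V d] by (rule finite_subset[rotated]) (auto simp: indep_lists_def)

text \<open>A list of \<open>d\<close> independent vectors can be prolonged by any vector outside its span, and the span has
  \<open>q\<^sup>d\<close> elements.\<close>

lemma card_indep_lists:
  assumes V: "subspace V" "finite V" and "d \<le> dim V"
  shows "card (indep_lists V d) = (\<Prod>r<d. CARD('a) ^ dim V - CARD('a) ^ r)"
  using \<open>d \<le> dim V\<close>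
proof (induction d)
  case 0
  have "indep_lists V 0 = {[]}" by (auto simp: indep_lists_def independent_empty)
  then show ?case by simp
next
  case (Suc d)
  let ?S = "SIGMA xs : indep_lists V d. V - span (set xs)"
  have "indep_lists V (Suc d) = (\<lambda>(xs, v). v # xs) ` ?S"
  proof (intro equalityI subsetI)
    fix ys assume "ys \<in> indep_lists V (Suc d)"
    then obtain v xs where "ys = v # xs" "(xs, v) \<in> ?S"
      by (cases ys) (auto simp: indep_lists_def independent_insert)
    then show "ys \<in> (\<lambda>(xs, v). v # xs) ` ?S" by force
  qed (auto simp: indep_lists_def span_base dest: dependent_insertD)
  moreover have "inj_on (\<lambda>(xs, v). v # xs) ?S" by (auto simp: inj_on_def)
  ultimately have "card (indep_lists V (Suc d)) = card ?S"
    by (simp add: card_image)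
  also have "\<dots> = (\<Sum>xs\<in>indep_lists V d. card (V - span (set xs)))"
    using V(2) by (intro card_SigmaI) (auto intro: finite_indep_lists)
  also have "\<dots> = (\<Sum>xs\<in>indep_lists V d. CARD('a) ^ dim V - CARD('a) ^ d)"
  proof (rule sum.cong)
    fix xs assume "xs \<in> indep_lists V d"
    note * = indep_lists_span[OF V this]
    show "card (V - span (set xs)) = CARD('a) ^ dim V - CARD('a) ^ d"
      using card_Diff_subset[OF finite_subset[OF *(1) V(2)] *(1)] *(2) card_subspace[OF V] by simp
  qed simp
  finally show ?case using Suc by simp
qed

text \<open>Every list of \<open>d\<close> independent vectors of \<open>V\<close> is an ordered basis of exactly one
  \<open>d\<close>-dimensional subspace, and all subspaces of dimension \<open>d\<close> have equally many ordered bases.\<close>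

lemma card_subspaces_of_dim:
  assumes V: "subspace V" "finite V" and d: "d \<le> dim V"
  shows "card {U. subspace U \<and> U \<subseteq> V \<and> dim U = d} * (\<Prod>r<d. CARD('a) ^ d - CARD('a) ^ r)
      = (\<Prod>r<d. CARD('a) ^ dim V - CARD('a) ^ r)"
proof -
  let ?G = "{U. subspace U \<and> U \<subseteq> V \<and> dim U = d}"
  have fin: "finite U" if "U \<in> ?G" for U using that V(2) finite_subset by auto
  have span_eq: "span (set xs) = U" if "U \<in> ?G" "xs \<in> indep_lists U d" for U xs
    using that fin[OF that(1)] indep_lists_span[of U xs d] by (intro subspace_eqI) auto
  have "indep_lists V d = (\<Union>U\<in>?G. indep_lists U d)"
  proof (intro equalityI subsetI)
    fix xs assume xs: "xs \<in> indep_lists V d"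
    then have "span (set xs) \<in> ?G" using indep_lists_span[OF V xs] by simp
    moreover have "xs \<in> indep_lists (span (set xs)) d"
      using xs by (auto simp: indep_lists_def span_base)
    ultimately show "xs \<in> (\<Union>U\<in>?G. indep_lists U d)" by blast
  qed (auto simp: indep_lists_def)
  also have "card \<dots> = (\<Sum>U\<in>?G. card (indep_lists U d))"
  proof (rule card_UN_disjoint)
    show "finite ?G" using V(2) by (auto intro: finite_subset[of _ "Pow V"])
    show "\<forall>U\<in>?G. finite (indep_lists U d)" using fin finite_indep_lists by blast
    show "\<forall>U\<in>?G. \<forall>U'\<in>?G. U \<noteq> U' \<longrightarrow> indep_lists U d \<inter> indep_lists U' d = {}"
      using span_eq by blast
  qed
  also have "\<dots> = (\<Sum>U\<in>?G. \<Prod>r<d. CARD('a) ^ d - CARD('a) ^ r)"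
    using fin card_indep_lists by (intro sum.cong) auto
  finally show ?thesis using card_indep_lists[OF V d] by simp
qed

end

end

text \<open>This passes from dimensions to codimensions. It holds because, in terms of
  \<open>F\<^sub>k = (q - 1) (q\<^sup>2 - 1) \<dots> (q\<^sup>k - 1)\<close>, the Gaussian binomial is \<open>F\<^sub>m / (F\<^sub>s F\<^bsub>m-s\<^esub>)\<close>.\<close>

lemma gauss_binomial_symmetric:
  assumes "2 \<le> q" and "s \<le> m"
  shows "gauss_binomial q m (m - s) = gauss_binomial q m s"
proof -
  define F where "F k = (\<Prod>r<k. real q ^ Suc r - 1)" for k
  have "real q ^ Suc r \<noteq> 1" for r
  proof -
    have "1 < real q ^ Suc r"
      by (rule one_less_power) (use assms(1) in simp_all)
    then show ?thesis by linarith
  qed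
  then have F_nz: "F k \<noteq> 0" for k
    by (simp add: F_def del: power_Suc)
  have F: "(\<Prod>r<d. real q ^ (k - r) - 1) * F (k - d) = F k" if "d \<le> k" for d k
    using that
  proof (induction d)
    case (Suc d)
    then have "F (k - d) = (real q ^ (k - d) - 1) * F (k - Suc d)"
      by (simp add: F_def Suc_diff_Suc[symmetric] mult.commute)
    then show ?case using Suc by simp
  qed simp
  have "gauss_binomial q m d = F m / (F d * F (m - d))" if "d \<le> m" for d
    using F[OF that] F[of d d] F_nz[of "m - d"] F_nz[of d]
    by (simp add: gauss_binomial_def prod_dividef F_def[of 0] field_simps)
  from this[of s] this[of "m - s"] show ?thesis
    using assms(2) by (simp add: mult.commute)
qed

text \<open>The factor \<open>q\<^sup>0 q\<^sup>1 \<dots> q\<^bsup>d-1\<^esup>\<close> split off here does not depend on \<open>m\<close>, so it cancels when two such counts are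
  compared.\<close>

lemma prod_power_diff:
  assumes "2 \<le> q" and "d \<le> m"
  shows "real (\<Prod>r<d. q ^ m - q ^ r) = (\<Prod>r<d. real q ^ r) * (\<Prod>r<d. real q ^ (m - r) - 1)"
proof -
  have "real (q ^ m - q ^ r) = real q ^ r * (real q ^ (m - r) - 1)" if "r < d" for r
  proof -
    have "q ^ r \<le> q ^ m" using assms that by (intro power_increasing) auto
    then have "real (q ^ m - q ^ r) = real q ^ m - real q ^ r" by (simp add: of_nat_diff)
    also have "real q ^ m = real q ^ r * real q ^ (m - r)"
      using assms(2) that by (simp flip: power_add)
    finally show ?thesis by (simp add: right_diff_distrib)
  qed
  then show ?thesis by (simp add: prod.distrib[symmetric])
qed

lemma card_codim_subspaces:
  assumes vs: "vector_space (scale :: 'k::{field,finite} \<Rightarrow> 'v::ab_group_add \<Rightarrow> 'v)"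
    and V: "module.subspace scale V" "finite V" and s: "s \<le> vector_space.dim scale V"
  shows "real (card {U. module.subspace scale U \<and> U \<subseteq> V
      \<and> vector_space.dim scale U + s = vector_space.dim scale V})
    = gauss_binomial CARD('k) (vector_space.dim scale V) s"
proof -
  interpret vector_space scale by fact
  let ?q = "CARD('k)" and ?m = "dim V"
  define d where "d = ?m - s"
  have d: "d \<le> ?m" by (simp add: d_def)
  have q: "2 \<le> ?q"
    using card_mono[of "UNIV :: 'k set" "{0, 1}"] by simp
  let ?N = "card {U. subspace U \<and> U \<subseteq> V \<and> dim U = d}"
  have "real ?N * real (\<Prod>r<d. ?q ^ d - ?q ^ r) = real (\<Prod>r<d. ?q ^ ?m - ?q ^ r)"
    using arg_cong[OF card_subspaces_of_dim[OF finite V d], of real] by (simp only: of_nat_mult)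
  then have "(\<Prod>r<d. real ?q ^ r) * (real ?N * (\<Prod>r<d. real ?q ^ (d - r) - 1))
      = (\<Prod>r<d. real ?q ^ r) * (\<Prod>r<d. real ?q ^ (?m - r) - 1)"
    by (simp only: prod_power_diff[OF q order_refl] prod_power_diff[OF q d] mult.left_commute)
  moreover have "(\<Prod>r<d. real ?q ^ r) \<noteq> 0" by simp
  ultimately have "real ?N * (\<Prod>r<d. real ?q ^ (d - r) - 1) = (\<Prod>r<d. real ?q ^ (?m - r) - 1)"
    by (simp only: mult_cancel_left) simp
  moreover have "real ?q ^ (d - r) - 1 \<noteq> 0" if "r < d" for r
  proof -
    have "1 < real ?q ^ (d - r)"
      by (rule one_less_power) (use q that in simp_all)
    then show ?thesis by simp
  qed
  ultimately have "real ?N = gauss_binomial ?q ?m d"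
    unfolding gauss_binomial_def prod_dividef by (simp add: field_simps)
  moreover have "{U. subspace U \<and> U \<subseteq> V \<and> dim U + s = ?m} = {U. subspace U \<and> U \<subseteq> V \<and> dim U = d}"
    using s by (auto simp: d_def)
  ultimately show ?thesis
    using gauss_binomial_symmetric[OF q s] by (simp add: d_def)
qed

section \<open>Terminal completions\<close>

text \<open>The nilpotency exponent is written as \<open>Suc N\<close>, so that the terminal layer is given by \<open>J\<^sup>N\<close>.\<close>

locale basic_split_algebra = finite_dim_algebra scale
  for scale :: "'k::field \<Rightarrow> 'r::ring_1 \<Rightarrow> 'r" +
  fixes e :: "nat \<Rightarrow> 'r" and t N i j :: nat
  assumes complete: "complete_primitive_orthogonal t e"
    and basic: "basic_algebra t e"
    and split: "split_algebra scale t e"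
    and nilpotent: "rad_pow (Suc N) = ({0} :: 'r set)"
    and i: "i \<in> {1..t}" and j: "j \<in> {1..t}"
begin

lemma primitive: "h \<in> {1..t} \<Longrightarrow> primitive_idempotent (e h)"
  and orthogonal: "h \<in> {1..t} \<Longrightarrow> l \<in> {1..t} \<Longrightarrow> h \<noteq> l \<Longrightarrow> e h * e l = 0"
  and sum_idempotents: "(\<Sum>h=1..t. e h) = 1"
  using complete unfolding complete_primitive_orthogonal_def by blast+

lemma idempotent: "h \<in> {1..t} \<Longrightarrow> e h * e h = e h"
  using primitive unfolding primitive_idempotent_def by blast

lemma off_diagonal_in_radical:
  assumes "h \<in> {1..t}" "l \<in> {1..t}" "h \<noteq> l"
  shows "e h * a * e l \<in> jacobson_radical"
proof (rule corner_subset_jacobson_radical[OF finite_dim_algebra_axioms nilpotent])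
  show "e h * (e h * a * e l) = e h * a * e l"
    by (simp add: mult.assoc[symmetric] idempotent[OF assms(1)])
  show "e h * a * e l * e l = e h * a * e l"
    by (simp add: mult.assoc idempotent[OF assms(2)])
qed (use assms primitive idempotent basic split in
    \<open>auto simp: basic_algebra_def split_algebra_def\<close>)

lemma diagonal_decomp:
  assumes "h \<in> {1..t}"
  obtains c u where "e h * a * e h = scale c (e h) + u" "u \<in> corner (e h) jacobson_radical (e h)"
  using split_idempotent_decomp[OF finite_dim_algebra_axioms _ idempotent[OF assms]] split assms
  unfolding split_algebra_def by blast

text \<open>As \<open>J\<^sup>N\<close> is closed under right multiplication, this is \<open>J\<^sup>N P\<close> for \<open>P = \<Lambda> e\<^sub>i\<close>.\<close>

definition terminal_layer :: "'r set" where
  "terminal_layer = {a * e i | a. a \<in> rad_pow N}"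

lemma terminal_layer_eq: "terminal_layer = ideal_smult (rad_pow N) (proj_module (e i))"
  by (simp add: terminal_layer_def ideal_smult_proj_module)

lemma terminal_layer_rad_pow: "x \<in> terminal_layer \<Longrightarrow> x \<in> rad_pow N"
  unfolding terminal_layer_def using rad_pow_mult_right by blast

lemma terminal_layer_right: "x \<in> terminal_layer \<Longrightarrow> x * e i = x"
  unfolding terminal_layer_def by (auto simp: mult.assoc idempotent[OF i])

lemma terminal_layer_iff: "x \<in> terminal_layer \<longleftrightarrow> x \<in> rad_pow N \<and> x * e i = x"
proof
  assume "x \<in> rad_pow N \<and> x * e i = x"
  then show "x \<in> terminal_layer" unfolding terminal_layer_def by (metis (mono_tags, lifting) mem_Collect_eq)
qed (simp add: terminal_layer_rad_pow terminal_layer_right)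

lemma terminal_layer_left_ideal: "left_ideal terminal_layer"
  unfolding left_ideal_iff terminal_layer_iff
  by (auto simp: distrib_right mult.assoc terminal_layer_rad_pow terminal_layer_right
      left_ideal_closed[OF rad_pow_left_ideal])

lemma corner_radical_terminal_layer: "u \<in> corner y jacobson_radical z \<Longrightarrow> x \<in> terminal_layer \<Longrightarrow> u * x = 0"
  using corner_jacobson_mult[of u y z x N] nilpotent terminal_layer_rad_pow by blast

lemma terminal_layer_radical: "x \<in> terminal_layer \<Longrightarrow> a \<in> jacobson_radical \<Longrightarrow> x * a = 0"
  using rad_pow_mult_jacobson[of x N a] nilpotent terminal_layer_rad_pow by blast

lemma V_space_eq: "V_space e (Suc N) i j = {x \<in> terminal_layer. e j * x = x}"
proof
  have "e j * a * e i \<in> terminal_layer \<and> e j * (e j * a * e i) = e j * a * e i" if "a \<in> rad_pow N" for a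
    using that left_ideal_closed(3)[OF rad_pow_left_ideal, of a N "e j"]
    by (auto simp: terminal_layer_def mult.assoc[symmetric] idempotent[OF j])
  then show "V_space e (Suc N) i j \<subseteq> {x \<in> terminal_layer. e j * x = x}"
    unfolding V_space_def corner_def by auto
  show "{x \<in> terminal_layer. e j * x = x} \<subseteq> V_space e (Suc N) i j"
    unfolding V_space_def corner_def
    by (auto simp: terminal_layer_iff mult.assoc intro!: exI[of "\<lambda>a. _ = e j * (a * e i) \<and> _ a"])
qed

lemma subspace_V_space: "subspace (V_space e (Suc N) i j)"
proof (rule subspaceI)
  fix x c assume "x \<in> V_space e (Suc N) i j"
  then show "scale c x \<in> V_space e (Suc N) i j"
    using left_ideal_closed(3)[OF terminal_layer_left_ideal, of x "scale c 1"]
    unfolding V_space_eq by (simp add: scale_mult_left scale_mult_right)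
qed (use left_ideal_closed[OF terminal_layer_left_ideal] in \<open>auto simp: V_space_eq distrib_left\<close>)

text \<open>Decompose \<open>x = \<Sum>\<^sub>h e\<^sub>h x\<close>: the space \<open>W\<close> provides all components with \<open>h \<noteq> j\<close>, so only the component at \<open>j\<close>
  is constrained. In this form closure under \<open>\<Lambda>\<close> can be checked on one component.\<close>

lemma kernel_eq:
  assumes U: "subspace U" "U \<subseteq> V_space e (Suc N) i j"
  shows "W_space e t (Suc N) i j + U = {x \<in> terminal_layer. e j * x \<in> U}"
proof
  have W: "W_space e t (Suc N) i j = {sum w ({1..t} - {j}) | w. \<forall>h\<in>{1..t} - {j}. w h \<in> e h *o terminal_layer}"
    unfolding W_space_def by (simp add: terminal_layer_eq set_sum_alt)
  show "W_space e t (Suc N) i j + U \<subseteq> {x \<in> terminal_layer. e j * x \<in> U}"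
  proof
    fix x assume "x \<in> W_space e t (Suc N) i j + U"
    then obtain y u where y: "y \<in> W_space e t (Suc N) i j" and u: "u \<in> U"
      and xyu: "x = y + u"
      by (rule set_plus_elim)
    obtain w where w: "\<forall>h\<in>{1..t} - {j}. w h \<in> e h *o terminal_layer"
      and x: "x = sum w ({1..t} - {j}) + u"
      using y unfolding xyu W by blast
    have w': "w h \<in> terminal_layer" "e j * w h = 0" if "h \<in> {1..t} - {j}" for h
    proof -
      have "w h \<in> e h *o terminal_layer" using w that by (rule bspec)
      then obtain y where y: "y \<in> terminal_layer" "w h = e h * y"
        unfolding elt_set_times_def by blast
      show "w h \<in> terminal_layer" unfolding y(2) by (rule left_ideal_closed(3)[OF terminal_layer_left_ideal y(1)])
      show "e j * w h = 0" using that orthogonal[OF j, of h] by (auto simp: y(2) mult.assoc[symmetric])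
    qed
    have "u \<in> terminal_layer" "e j * u = u" using u U(2) by (auto simp: V_space_eq)
    moreover have "sum w ({1..t} - {j}) \<in> terminal_layer"
      by (rule left_ideal_sum[OF terminal_layer_left_ideal w'(1)])
    moreover have "e j * sum w ({1..t} - {j}) = 0"
      by (simp add: sum_distrib_left w'(2))
    ultimately show "x \<in> {x \<in> terminal_layer. e j * x \<in> U}"
      using u left_ideal_closed(2)[OF terminal_layer_left_ideal] by (simp add: x distrib_left)
  qed
  show "{x \<in> terminal_layer. e j * x \<in> U} \<subseteq> W_space e t (Suc N) i j + U"
  proof clarify
    fix x assume x: "x \<in> terminal_layer" "e j * x \<in> U"
    have "x = (\<Sum>h=1..t. e h * x)"
      by (simp only: sum_distrib_right[symmetric] sum_idempotents mult_1_left)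
    also have "\<dots> = (\<Sum>h\<in>{1..t} - {j}. e h * x) + e j * x"
      using j by (simp add: sum.remove[of _ j] add.commute)
    finally have eq: "x = (\<Sum>h\<in>{1..t} - {j}. e h * x) + e j * x" .
    have "(\<Sum>h\<in>{1..t} - {j}. e h * x) \<in> W_space e t (Suc N) i j"
      unfolding W using x(1) by (intro CollectI exI[of _ "\<lambda>h. e h * x"]) (auto simp: elt_set_times_def)
    then show "x \<in> W_space e t (Suc N) i j + U"
      by (subst eq) (rule set_plus_intro[OF _ x(2)])
  qed
qed

text \<open>
  Modulo elements that annihilate \<open>J\<^sup>N P\<close>, the row \<open>e\<^sub>j \<Lambda>\<close> of the algebra is just \<open>k e\<^sub>j\<close>: the
  entries off the diagonal are radical because the algebra is basic, and the diagonal one is scalar up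
  to the radical because it is split. So the condition \<open>e\<^sub>j x \<in> U\<close> is stable under \<open>\<Lambda>\<close> for every
  subspace \<open>U\<close>.
\<close>

lemma kernel_submodule:
  assumes U: "subspace U" "U \<subseteq> V_space e (Suc N) i j"
  shows "submodule (W_space e t (Suc N) i j + U) (proj_module (e i))"
proof -
  let ?K = "{x \<in> terminal_layer. e j * x \<in> U}"
  have "left_ideal ?K"
    unfolding left_ideal_iff
  proof (intro conjI ballI allI)
    show "0 \<in> ?K" using left_ideal_closed(1)[OF terminal_layer_left_ideal] subspace_0[OF U(1)] by simp
    show "x + y \<in> ?K" if "x \<in> ?K" "y \<in> ?K" for x y
      using that left_ideal_closed(2)[OF terminal_layer_left_ideal] subspace_add[OF U(1)]
      by (simp add: distrib_left)
    fix a x assume x: "x \<in> ?K"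
    obtain c u where cu: "e j * a * e j = scale c (e j) + u" "u \<in> corner (e j) jacobson_radical (e j)"
      by (rule diagonal_decomp[OF j])
    have off: "e j * a * e l * x = 0" if "l \<in> {1..t} - {j}" for l
    proof (rule corner_radical_terminal_layer)
      show "e j * a * e l \<in> corner 1 jacobson_radical 1"
        using off_diagonal_in_radical[OF j, of l a] that by (auto simp: corner_def)
    qed (use x in simp)
    have "e j * (a * x) = e j * a * (\<Sum>l=1..t. e l) * x"
      by (simp only: sum_idempotents mult_1_right mult.assoc)
    also have "\<dots> = (\<Sum>l=1..t. e j * a * e l * x)"
      by (simp add: sum_distrib_left sum_distrib_right)
    also have "\<dots> = e j * a * e j * x"
      using j off by (simp add: sum.remove[of _ j])
    also have "\<dots> = scale c (e j * x)"
      using corner_radical_terminal_layer[OF cu(2), of x] x by (simp add: cu(1) distrib_right scale_mult_left)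
    finally show "a * x \<in> ?K"
      using x left_ideal_closed(3)[OF terminal_layer_left_ideal] subspace_scale[OF U(1)] by simp
  qed
  moreover have "?K \<subseteq> {a * e i | a. True}" by (auto simp: terminal_layer_def)
  ultimately show ?thesis
    unfolding kernel_eq[OF U] proj_module_def submodule_left_ideal_module by simp
qed

lemma left_module_terminal_completion:
  assumes "subspace U" "U \<subseteq> V_space e (Suc N) i j"
  shows "left_module (terminal_completion e t (Suc N) i j U)"
  unfolding terminal_completion_def
  by (rule left_module.left_module_quotient[OF left_module_proj_module kernel_submodule[OF assms]])

text \<open>The kernel lies in \<open>J\<^sup>N P\<close>, hence in \<open>J\<^sup>d P\<close> for all \<open>d \<le> N\<close>.\<close>

lemma terminal_completion_tower:
  assumes U: "subspace U" "U \<subseteq> V_space e (Suc N) i j"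
  shows "has_proper_radical_tower e (Suc N) i (terminal_completion e t (Suc N) i j U)"
  unfolding has_proper_radical_tower_def terminal_completion_def
proof (intro allI impI)
  fix d assume "1 \<le> d \<and> d < Suc N"
  then have "W_space e t (Suc N) i j + U \<subseteq> ideal_smult (rad_pow d) (proj_module (e i))"
    using rad_pow_antimono[of d N] unfolding kernel_eq[OF U] ideal_smult_proj_module terminal_layer_def by auto
  then show "module_isomorphic
      (quotient_module (quotient_module (proj_module (e i)) (W_space e t (Suc N) i j + U))
        (ideal_smult (rad_pow d) (quotient_module (proj_module (e i)) (W_space e t (Suc N) i j + U))))
      (quotient_module (proj_module (e i)) (ideal_smult (rad_pow d) (proj_module (e i))))"
    by (rule left_module.quotient_mod_ideal_smult[OF left_module_proj_module kernel_submodule[OF U]])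
qed

text \<open>
  Let \<open>K\<close> and \<open>K'\<close> be the kernels belonging to \<open>U\<close> and \<open>U'\<close>. An isomorphism sends the generator
  \<open>e\<^sub>i + K\<close> to the class of some \<open>a \<in> e\<^sub>i \<Lambda> e\<^sub>i\<close>, so it is induced by right multiplication by
  \<open>a = c e\<^sub>i + u\<close> with \<open>u \<in> e\<^sub>i J e\<^sub>i\<close>. On \<open>J\<^sup>N P\<close> this is the scalar \<open>c\<close>. If \<open>c\<close> were zero, all of
  \<open>J\<^sup>N P\<close> would be sent to \<open>0\<close> and thus lie in \<open>K\<close>, which the properness of \<open>U\<close> excludes. So
  \<open>c x \<in> K'\<close> for \<open>x \<in> U\<close> yields \<open>x \<in> U'\<close>.
\<close>

lemma terminal_completion_iso_imp_subset:
  assumes U: "subspace U" "U \<subset> V_space e (Suc N) i j"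
    and U': "subspace U'" "U' \<subseteq> V_space e (Suc N) i j"
    and iso: "module_isomorphic (terminal_completion e t (Suc N) i j U)
      (terminal_completion e t (Suc N) i j U')"
  shows "U \<subseteq> U'"
proof -
  let ?P = "proj_module (e i)"
  interpret P: left_module ?P by (rule left_module_proj_module)
  define K where "K = W_space e t (Suc N) i j + U"
  define K' where "K' = W_space e t (Suc N) i j + U'"
  have UV: "U \<subseteq> V_space e (Suc N) i j" using U(2) by blast
  have K: "submodule K ?P" and K': "submodule K' ?P"
    unfolding K_def K'_def using kernel_submodule U(1) UV U' by blast+
  note pi = P.surj_hom_coset_of[OF K] and pi' = P.surj_hom_coset_of[OF K']
  let ?\<pi> = "coset_of ?P K" and ?\<pi>' = "coset_of ?P K'"
  obtain f where bij: "bij_betw f (mcarrier (quotient_module ?P K)) (mcarrier (quotient_module ?P K'))"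
    and f_smult: "\<And>a y. y \<in> mcarrier (quotient_module ?P K)
        \<Longrightarrow> f (msmult (quotient_module ?P K) a y) = msmult (quotient_module ?P K') a (f y)"
    using iso unfolding module_isomorphic_def terminal_completion_def K_def K'_def by blast
  have ei: "e i \<in> mcarrier ?P" by (auto intro: exI[of _ 1])
  have "f (?\<pi> (e i)) \<in> mcarrier (quotient_module ?P K')"
    using surj_hom_closed[OF pi ei] bij by (auto simp: bij_betw_def)
  then obtain b where "b \<in> mcarrier ?P" "f (?\<pi> (e i)) = ?\<pi>' b"
    by (rule surj_homE[OF pi'])
  then obtain r where r: "f (?\<pi> (e i)) = ?\<pi>' (r * e i)" by auto
  \<comment> \<open>Left multiplication by \<open>e i\<close> fixes the generator, so its image may be multiplied by \<open>e i\<close> too.\<close>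
  define a where "a = e i * r * e i"
  have f_eq: "f (?\<pi> x) = ?\<pi>' (x * a)" if "x * e i = x" for x
  proof -
    have "f (?\<pi> (x * e i)) = f (msmult (quotient_module ?P K) x (?\<pi> (e i)))"
      using surj_hom_smult[OF pi ei, of x] by simp
    also have "\<dots> = msmult (quotient_module ?P K') x (?\<pi>' (r * e i))"
      by (simp add: f_smult[OF surj_hom_closed[OF pi ei]] r)
    also have "\<dots> = ?\<pi>' (x * (r * e i))"
      using surj_hom_smult[OF pi', of "r * e i" x] by auto
    also have "x * (r * e i) = x * a"
      using that by (simp add: a_def mult.assoc[symmetric])
    finally show ?thesis using that by simp
  qed
  have in_K_iff: "x \<in> K \<longleftrightarrow> x * a \<in> K'" if "x * e i = x" for x
  proof -
    have x: "x \<in> mcarrier ?P" using that by (auto intro: exI[of _ x] dest: sym)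
    have xa: "x * a \<in> mcarrier ?P" by (auto simp: a_def mult.assoc[symmetric])
    have "x \<in> K \<longleftrightarrow> ?\<pi> x = ?\<pi> 0"
      using P.coset_of_eq_zero_iff[OF K x] by simp
    also have "\<dots> \<longleftrightarrow> f (?\<pi> x) = f (?\<pi> 0)"
      using inj_on_eq_iff[OF bij_betw_imp_inj_on[OF bij]] surj_hom_closed[OF pi] x P.zero_closed
      by simp
    also have "\<dots> \<longleftrightarrow> ?\<pi>' (x * a) = ?\<pi>' 0"
      using f_eq[OF that] f_eq[of 0] by simp
    also have "\<dots> \<longleftrightarrow> x * a \<in> K'"
      using P.coset_of_eq_zero_iff[OF K' xa] by simp
    finally show ?thesis .
  qed
  obtain c u where cu: "a = scale c (e i) + u" "u \<in> corner (e i) jacobson_radical (e i)"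
    unfolding a_def by (rule diagonal_decomp[OF i])
  have terminal_layer_a: "x * a = scale c x" if x: "x \<in> terminal_layer" for x
  proof -
    obtain w where w: "w \<in> jacobson_radical" "u = e i * w * e i"
      using cu(2) by (auto simp: corner_def)
    have "x * u = x * e i * w * e i" by (simp add: w(2) mult.assoc)
    also have "\<dots> = 0" using terminal_layer_right[OF x] terminal_layer_radical[OF x w(1)] by simp
    finally show ?thesis
      using terminal_layer_right[OF x] by (simp add: cu(1) distrib_left scale_mult_right)
  qed
  have K_iff: "x \<in> U \<longleftrightarrow> scale c x \<in> K'" if "x \<in> V_space e (Suc N) i j" for x
    using that in_K_iff[of x] terminal_layer_a[of x] terminal_layer_right[of x]
    unfolding K_def kernel_eq[OF U(1) UV] by (auto simp: V_space_eq)
  have "c \<noteq> 0"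
  proof
    assume "c = 0"
    then have "V_space e (Suc N) i j \<subseteq> U"
      using K_iff P.submodule_closed(1)[OF K'] by auto
    then show False using U(2) by blast
  qed
  show "U \<subseteq> U'"
  proof
    fix x assume x: "x \<in> U"
    then have "e j * x = x" "scale c x \<in> K'" using UV K_iff by (auto simp: V_space_eq)
    then have "scale c x \<in> U'"
      unfolding K'_def kernel_eq[OF U'] by (simp add: scale_mult_right)
    then show "x \<in> U'"
      using subspace_scale[OF U'(1), of "scale c x" "inverse c"] \<open>c \<noteq> 0\<close> by simp
  qed
qed

end

lemma card_quotient_image:
  assumes "\<And>x. x \<in> A \<Longrightarrow> (f x, f x) \<in> R" and "\<And>x y. x \<in> A \<Longrightarrow> y \<in> A \<Longrightarrow> (f x, f y) \<in> R \<Longrightarrow> x = y"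
  shows "card ((f ` A) // R) = card A"
proof -
  have "(f ` A) // R = (\<lambda>x. R `` {f x}) ` A"
    by (auto simp: quotient_def)
  moreover have "inj_on (\<lambda>x. R `` {f x}) A"
    using assms by (auto simp: inj_on_def)
  ultimately show ?thesis by (simp add: card_image)
qed

theorem theorem6p6:
  fixes scale :: "'k::{field,finite} \<Rightarrow> 'r::ring_1 \<Rightarrow> 'r"
    and e :: "nat \<Rightarrow> 'r" and t n i j q m s :: nat
  assumes "q = CARD('k)"
    and "finite_dim_algebra scale"
    and "complete_primitive_orthogonal t e"
    and "basic_algebra t e"
    and "split_algebra scale t e"
    and "n \<ge> 1"
    and "rad_pow n = ({0} :: 'r set)"
    and "i \<in> {1..t}" and "j \<in> {1..t}"
    and "V_space e n i j \<noteq> {0}"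
    and "m = vector_space.dim scale (V_space e n i j)"
    and "1 \<le> s" and "s \<le> m"
  shows "card ({M \<in> terminal_completions scale e t n i j s. has_proper_radical_tower e n i M}
                 // module_iso_rel) = card (F_classes scale e t n i j s)
         \<and> real (card (F_classes scale e t n i j s)) = gauss_binomial q m s"
proof -
  obtain N where n: "n = Suc N" using \<open>n \<ge> 1\<close> by (cases n) auto
  interpret A: finite_dim_algebra scale by fact
  interpret A: basic_split_algebra scale e t N i j
    using assms by unfold_locales (simp_all add: n)
  let ?V = "V_space e n i j" and ?C = "codim_subspaces scale (V_space e n i j) s"
  have V: "A.subspace ?V" using A.subspace_V_space by (simp add: n)
  have "finite (UNIV :: 'r set)"
    using A.finite_dim A.finite_span[OF finite] by metis
  then have finV: "finite ?V" by (rule finite_subset[OF subset_UNIV])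
  have C: "A.subspace U" "U \<subset> ?V" "A.dim U + s = A.dim ?V" if "U \<in> ?C" for U
    using that \<open>1 \<le> s\<close> by (auto simp: codim_subspaces_def)
  have eqI: "U = U'" if U: "U \<in> ?C" and U': "U' \<in> ?C"
    and iso: "module_isomorphic (terminal_completion e t n i j U) (terminal_completion e t n i j U')"
    for U U'
  proof (rule A.subspace_eqI[OF finite])
    show "U \<subseteq> U'"
      using A.terminal_completion_iso_imp_subset[of U U'] C[OF U] C[OF U'] iso by (simp add: n less_imp_le)
    show "finite U'" by (rule finite_subset[OF _ finV]) (use C(2)[OF U'] in blast)
    show "A.dim U = A.dim U'" using C(3)[OF U] C(3)[OF U'] by simp
  qed (use C U U' in blast)+
  have mod: "left_module (terminal_completion e t n i j U)"
    and tower: "has_proper_radical_tower e n i (terminal_completion e t n i j U)" if "U \<in> ?C" for U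
    using A.left_module_terminal_completion[of U] A.terminal_completion_tower[of U] C(1,2)[OF that]
    by (simp_all add: n less_imp_le)
  have refl: "module_isomorphic M M" for M :: "('r, 'r set) lmod"
    unfolding module_isomorphic_def by (intro exI[of _ id]) simp
  have "card (F_classes scale e t n i j s) = card ?C"
    unfolding F_classes_def terminal_completions_def
    by (rule card_quotient_image) (use mod refl eqI in \<open>auto simp: module_iso_rel_def\<close>)
  also have "real (card ?C) = gauss_binomial q m s"
    using card_codim_subspaces[OF A.vector_space_axioms V finV, of s] assms
    by (simp add: codim_subspaces_def)
  finally have "real (card (F_classes scale e t n i j s)) = gauss_binomial q m s" .
  moreover have "{M \<in> terminal_completions scale e t n i j s. has_proper_radical_tower e n i M}
      = terminal_completions scale e t n i j s"
    using tower by (auto simp: terminal_completions_def)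
  ultimately show ?thesis by (simp add: F_classes_def)
qed

end
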